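(* Let $d\in\mathbb{N}$, let $\xi,\xi_1,\xi_2,\ldots$ be i.i.d. random variables in $\mathbb{R}^d$ with $\mathbb{E}\|\xi\|<\infty$, and let $S_n:=\sum_{i=1}^n\xi_i$, $S_0:=0$, be the associated random walk on $\mathbb{R}^d$. Then for any $n\in\mathbb{N}$ and any $x\ge0$, $$\mathbb{P}\Big(\max_{0\le j\le n}\|S_j\|\ge3x\Big)\le3\max_{0\le j\le n}\mathbb{P}(\|S_j\|\ge x).$$
   Context: $\|\cdot\|$ is the Euclidean norm on $\mathbb{R}^d$. *)

theory Defs
  imports "HOL-Probability.Probability"
begin

text \<open>The steps are indexed from 1; the value at step index 0 is not used.\<close>

definition random_walk :: "(nat \<Rightarrow> 'w \<Rightarrow> 'a::comm_monoid_add) \<Rightarrow> nat \<Rightarrow> 'w \<Rightarrow> 'a" where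
  "random_walk \<xi>s n \<omega> = (\<Sum>i=1..n. \<xi>s i \<omega>)"

text \<open>
  \<open>\<xi>\<close> is a generic copy of the steps, so independence is only required of
  \<open>\<xi>s 1, \<xi>s 2, \<dots>\<close>. Measurability of the steps is part of \<open>indep_vars\<close>.
\<close>

definition iid_steps ::
  "'w measure \<Rightarrow> ('w \<Rightarrow> 'a::topological_space) \<Rightarrow> (nat \<Rightarrow> 'w \<Rightarrow> 'a) \<Rightarrow> bool" where
  "iid_steps M \<xi> \<xi>s \<longleftrightarrow>
     \<xi> \<in> borel_measurable M \<and>
     prob_space.indep_vars M (\<lambda>_. borel) \<xi>s {1..} \<and>
     (\<forall>i\<ge>1. distr M borel (\<xi>s i) = distr M borel \<xi>)"

end

theory Submission
  imports Defs
begin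

text \<open>
  This is Etemadi's inequality. Decompose the event according to the first time \<open>j\<close> at which
  \<open>\<parallel>S\<^sub>j\<parallel> \<ge> 3x\<close>. Unless \<open>\<parallel>S\<^sub>n\<parallel> \<ge> x\<close>, the
  increment \<open>S\<^sub>n - S\<^sub>j\<close> has norm greater than \<open>2x\<close>. It is independent of the first-passage
  event at \<open>j\<close>, and it can be that large only if \<open>\<parallel>S\<^sub>n\<parallel>\<close> or \<open>\<parallel>S\<^sub>j\<parallel>\<close> exceeds \<open>x\<close>.
\<close>

lemma borel_measurable_random_walk [measurable (raw)]:
  fixes X :: "nat \<Rightarrow> 'w \<Rightarrow> 'a::{second_countable_topology,real_normed_vector}"
  assumes "\<And>i. 1 \<le> i \<Longrightarrow> X i \<in> borel_measurable M"
  shows "random_walk X n \<in> borel_measurable M"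
  unfolding random_walk_def[abs_def] using assms by (intro borel_measurable_sum) auto

lemma random_walk_diff:
  fixes X :: "nat \<Rightarrow> 'w \<Rightarrow> 'a::ab_group_add"
  assumes "j \<le> n"
  shows "random_walk X n \<omega> - random_walk X j \<omega> = (\<Sum>i=Suc j..n. X i \<omega>)"
proof -
  have "{1..n} = {1..j} \<union> {Suc j..n}" using assms by auto
  then show ?thesis
    by (simp add: random_walk_def sum.union_disjoint)
qed

text \<open>The event is spelled out through the walk at indices 0 to \<open>j\<close> rather than
  through a hitting time, which makes visible that it depends on the first \<open>j\<close> steps
  alone. Index 0 counts: for \<open>t \<le> 0\<close> passage occurs already there.\<close>

definition first_passage ::
  "'w measure \<Rightarrow> (nat \<Rightarrow> 'w \<Rightarrow> 'a::real_normed_vector) \<Rightarrow> real \<Rightarrow> nat \<Rightarrow> 'w set" where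
  "first_passage M X t j =
    {\<omega>\<in>space M. t \<le> norm (random_walk X j \<omega>) \<and> (\<forall>k<j. norm (random_walk X k \<omega>) < t)}"

lemma sets_first_passage [measurable]:
  fixes X :: "nat \<Rightarrow> 'w \<Rightarrow> 'a::{second_countable_topology,real_normed_vector}"
  assumes [measurable]: "\<And>i. 1 \<le> i \<Longrightarrow> X i \<in> borel_measurable M"
  shows "first_passage M X t j \<in> sets M"
  unfolding first_passage_def by measurable

text \<open>Passage at the smaller index makes the norm reach \<open>t\<close> there, which passage
  at the larger index forbids.\<close>

lemma disjoint_family_first_passage: "disjoint_family (first_passage M X t)"
  unfolding disjoint_family_on_def
proof (intro ballI impI)
  fix i j :: nat
  assume "i \<noteq> j"
  then consider "i < j" | "j < i" by linarith
  then show "first_passage M X t i \<inter> first_passage M X t j = {}"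
    by cases (force simp: first_passage_def)+
qed

text \<open>Take the least index at which the norm reaches \<open>t\<close>; the given
  \<open>k\<close> is a candidate, so this index is at most \<open>n\<close>.\<close>

lemma first_passage_exists:
  assumes "\<omega> \<in> space M" "k \<le> n" "t \<le> norm (random_walk X k \<omega>)"
  obtains j where "j \<le> n" "\<omega> \<in> first_passage M X t j"
proof
  let ?j = "LEAST k. t \<le> norm (random_walk X k \<omega>)"
  show "?j \<le> n" using assms(2,3) Least_le[of "\<lambda>k. t \<le> norm (random_walk X k \<omega>)" k] by simp
  show "\<omega> \<in> first_passage M X t ?j"
    using assms(1) LeastI[of "\<lambda>k. t \<le> norm (random_walk X k \<omega>)", OF assms(3)]
    by (auto simp: first_passage_def not_le dest: not_less_Least)
qed

context prob_space
begin

text \<open>First passage at \<open>j\<close> is decided by the steps 1 to \<open>j\<close>, the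
  increment by the steps \<open>Suc j\<close> to \<open>n\<close>, and disjoint blocks of an
  independent family are independent.\<close>

lemma prob_first_passage_increment:
  fixes X :: "nat \<Rightarrow> 'a \<Rightarrow> 'b::{second_countable_topology,real_normed_vector}"
  assumes ind: "indep_vars (\<lambda>_. borel) X {1..}" and "j \<le> n"
  shows "prob (first_passage M X t j \<inter>
             {\<omega>\<in>space M. s < norm (random_walk X n \<omega> - random_walk X j \<omega>)})
       = prob (first_passage M X t j) *
         prob {\<omega>\<in>space M. s < norm (random_walk X n \<omega> - random_walk X j \<omega>)}"
proof -
  \<comment> \<open>Each block of steps becomes one random element of a product space.
    \<open>restrict\<close> makes the values outside the block \<open>undefined\<close>, as
    membership in that space demands.\<close>
  define past where "past = (\<lambda>\<omega>. restrict (\<lambda>i. X i \<omega>) {1..j})"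
  define future where "future = (\<lambda>\<omega>. restrict (\<lambda>i. X i \<omega>) {Suc j..n})"
  let ?P = "PiM {1..j} (\<lambda>_. borel :: 'b measure)" and ?F = "PiM {Suc j..n} (\<lambda>_. borel :: 'b measure)"
  have [measurable]: "X i \<in> borel_measurable M" if "1 \<le> i" for i
    using ind that by (auto simp: indep_vars_def)
  have iv: "indep_var ?P past ?F future"
    unfolding past_def future_def by (rule indep_var_restrict[OF ind]) auto
  \<comment> \<open>\<open>A\<close> and \<open>B\<close> express the two events in coordinates:
    their preimages under \<open>past\<close> and \<open>future\<close> are the first-passage event
    and the increment event.\<close>
  define A where "A = {f\<in>space ?P. t \<le> norm (\<Sum>i=1..j. f i) \<and> (\<forall>k<j. norm (\<Sum>i=1..k. f i) < t)}"
  define B where "B = {f\<in>space ?F. s < norm (\<Sum>i=Suc j..n. f i)}"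
  \<comment> \<open>The bound \<open>k \<le> j\<close> keeps all coordinates in the index set of
    \<open>?P\<close>, where projections are measurable.\<close>
  have [measurable]: "(\<lambda>f. \<Sum>i=1..k. f i) \<in> borel_measurable ?P" if "k \<le> j" for k
    using that by (intro borel_measurable_sum measurable_component_singleton) auto
  have [measurable]: "(\<lambda>f. \<Sum>i=Suc j..n. f i) \<in> borel_measurable ?F"
    by (intro borel_measurable_sum measurable_component_singleton) auto
  have A: "A \<in> sets ?P"
  proof -
    have "{f\<in>space ?P. \<forall>k\<in>{..<j}. norm (\<Sum>i=1..k. f i) < t} \<in> sets ?P"
      by (intro sets.sets_Collect_finite_All) auto
    moreover have "{f\<in>space ?P. t \<le> norm (\<Sum>i=1..j. f i)} \<in> sets ?P" by measurable
    moreover have "A = {f\<in>space ?P. t \<le> norm (\<Sum>i=1..j. f i)} \<inter>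
        {f\<in>space ?P. \<forall>k\<in>{..<j}. norm (\<Sum>i=1..k. f i) < t}"
      by (auto simp: A_def)
    ultimately show ?thesis by (simp only: sets.Int)
  qed
  have B: "B \<in> sets ?F"
    unfolding B_def by measurable
  have sp: "past \<omega> \<in> space ?P" "future \<omega> \<in> space ?F" for \<omega>
    by (auto simp: past_def future_def space_PiM)
  have S: "(\<Sum>i=1..k. past \<omega> i) = random_walk X k \<omega>" if "k \<le> j" for k \<omega>
    unfolding random_walk_def using that by (intro sum.cong) (auto simp: past_def)
  have T: "(\<Sum>i=Suc j..n. future \<omega> i) = random_walk X n \<omega> - random_walk X j \<omega>" for \<omega>
    by (simp add: random_walk_diff[OF \<open>j \<le> n\<close>] future_def)
  have
    pre: "past -` A \<inter> space M = first_passage M X t j"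
         "future -` B \<inter> space M = {\<omega>\<in>space M. s < norm (random_walk X n \<omega> - random_walk X j \<omega>)}"
    by (auto simp: A_def B_def first_passage_def sp S T simp del: One_nat_def)
  have "(\<lambda>\<omega>. (past \<omega>, future \<omega>)) -` (A \<times> B) \<inter> space M =
      (past -` A \<inter> space M) \<inter> (future -` B \<inter> space M)"
    by auto
  then show ?thesis
    using indep_varD[OF iv A B] by (simp add: pre)
qed

theorem Etemadi_inequality:
  fixes X :: "nat \<Rightarrow> 'a \<Rightarrow> 'b::{second_countable_topology,real_normed_vector}"
  assumes ind: "indep_vars (\<lambda>_. borel) X {1..}"
  shows "prob {\<omega>\<in>space M. (MAX j\<in>{0..n}. norm (random_walk X j \<omega>)) \<ge> 3 * x}
       \<le> 3 * (MAX j\<in>{0..n}. prob {\<omega>\<in>space M. norm (random_walk X j \<omega>) \<ge> x})"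
proof -
  define E where "E = (\<lambda>j. {\<omega>\<in>space M. norm (random_walk X j \<omega>) \<ge> x})"
  define p where "p = (MAX j\<in>{0..n}. prob (E j))"
  define D where
    "D = (\<lambda>j. {\<omega>\<in>space M. 2 * x < norm (random_walk X n \<omega> - random_walk X j \<omega>)})"
  let ?A = "first_passage M X (3 * x)"
  have [measurable]: "X i \<in> borel_measurable M" if "1 \<le> i" for i
    using ind that by (auto simp: indep_vars_def)
  have [measurable]: "E j \<in> events" "D j \<in> events" for j
    unfolding E_def D_def by measurable
  have p: "prob (E j) \<le> p" if "j \<le> n" for j
    unfolding p_def using that by (intro Max_ge) auto
  have D: "prob (D j) \<le> 2 * p" if "j \<le> n" for j
  proof -
    \<comment> \<open>If both norms were below \<open>x\<close>, the triangle inequality would keep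
      the increment below \<open>2 * x\<close>. The union bound then gives the factor 2 in
      \<open>2 * p\<close>.\<close>
    have "D j \<subseteq> E n \<union> E j"
    proof
      fix \<omega> assume "\<omega> \<in> D j"
      then show "\<omega> \<in> E n \<union> E j"
        using norm_triangle_ineq4[of "random_walk X n \<omega>" "random_walk X j \<omega>"]
        by (auto simp: D_def E_def)
    qed
    then have "prob (D j) \<le> prob (E n \<union> E j)" by (intro finite_measure_mono) auto
    also have "\<dots> \<le> prob (E n) + prob (E j)" by (intro measure_Un_le) auto
    finally show ?thesis using p[OF that] p[of n] by simp
  qed
  \<comment> \<open>At first passage the norm is at least \<open>3 * x\<close>, and outside
    \<open>E n\<close> the endpoint has norm below \<open>x\<close>; the reverse triangle inequality
    leaves an increment strictly above \<open>2 * x\<close>.\<close>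
  have "{\<omega>\<in>space M. (MAX j\<in>{0..n}. norm (random_walk X j \<omega>)) \<ge> 3 * x}
      \<subseteq> E n \<union> (\<Union>j\<in>{0..n}. ?A j \<inter> D j)"
  proof
    fix \<omega> assume "\<omega> \<in> {\<omega>\<in>space M. (MAX j\<in>{0..n}. norm (random_walk X j \<omega>)) \<ge> 3 * x}"
    then obtain k where "\<omega> \<in> space M" "k \<le> n" "3 * x \<le> norm (random_walk X k \<omega>)"
      by (auto simp: Max_ge_iff)
    then obtain j where j: "j \<le> n" "\<omega> \<in> ?A j"
      by (rule first_passage_exists)
    then show "\<omega> \<in> E n \<union> (\<Union>j\<in>{0..n}. ?A j \<inter> D j)"
      using norm_triangle_ineq2[of "random_walk X j \<omega>" "random_walk X n \<omega>"]
        norm_minus_commute[of "random_walk X j \<omega>" "random_walk X n \<omega>"]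
      by (force simp: E_def D_def first_passage_def)
  qed
  then have "prob {\<omega>\<in>space M. (MAX j\<in>{0..n}. norm (random_walk X j \<omega>)) \<ge> 3 * x}
      \<le> prob (E n \<union> (\<Union>j\<in>{0..n}. ?A j \<inter> D j))"
    by (rule finite_measure_mono) measurable
  also have "\<dots> \<le> prob (E n) + prob (\<Union>j\<in>{0..n}. ?A j \<inter> D j)"
    by (rule measure_Un_le) measurable
  also have "prob (\<Union>j\<in>{0..n}. ?A j \<inter> D j) \<le> (\<Sum>j\<in>{0..n}. prob (?A j \<inter> D j))"
    by (rule finite_measure_subadditive_finite) auto
  also have "\<dots> = (\<Sum>j\<in>{0..n}. prob (?A j) * prob (D j))"
    unfolding D_def by (intro sum.cong refl prob_first_passage_increment[OF ind]) simp
  also have "\<dots> \<le> (\<Sum>j\<in>{0..n}. prob (?A j) * (2 * p))"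
    using D by (intro sum_mono mult_left_mono) auto
  also have "\<dots> = (\<Sum>j\<in>{0..n}. prob (?A j)) * (2 * p)"
    by (simp add: sum_distrib_right)
  \<comment> \<open>By disjointness the passage probabilities add up to that of a single event,
    hence to at most 1, so no factor growing with \<open>n\<close> appears.\<close>
  also have "(\<Sum>j\<in>{0..n}. prob (?A j)) = prob (\<Union>j\<in>{0..n}. ?A j)"
    using disjoint_family_first_passage
    by (intro finite_measure_finite_Union[symmetric])
      (auto intro: disjoint_family_on_mono[OF subset_UNIV])
  also have "\<dots> * (2 * p) \<le> 1 * (2 * p)"
    using order_trans[OF measure_nonneg p[of n]] by (intro mult_right_mono) auto
  \<comment> \<open>The event \<open>E n\<close> contributes one \<open>p\<close> and the large
    increments contribute \<open>2 * p\<close>, which makes the constant 3.\<close>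
  finally show ?thesis
    using p[OF order_refl] unfolding p_def E_def by linarith
qed

end

theorem lemmaA1:
  fixes M :: "'w measure"
    and \<xi> :: "'w \<Rightarrow> real ^ 'd"
    and \<xi>s :: "nat \<Rightarrow> 'w \<Rightarrow> real ^ 'd"
    and n :: nat and x :: real
  assumes "prob_space M"
    and "iid_steps M \<xi> \<xi>s"
    and "integrable M (\<lambda>\<omega>. norm (\<xi> \<omega>))"
    and "x \<ge> 0"
  shows "measure M {\<omega> \<in> space M. (MAX j\<in>{0..n}. norm (random_walk \<xi>s j \<omega>)) \<ge> 3 * x}
       \<le> 3 * (MAX j\<in>{0..n}. measure M {\<omega> \<in> space M. norm (random_walk \<xi>s j \<omega>) \<ge> x})"
  using assms(1,2) by (intro prob_space.Etemadi_inequality) (auto simp: iid_steps_def)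

end
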